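(* Let $D$ be a skeletal directed acyclic graph. For any two join irreducibles $J$ and $J'$ of the acyclic reorientation lattice $\mathcal{AR}_D$, $J$ forces $J'$ if and only if the rope $\rho_\vee(J)$ is a subrope of the rope $\rho_\vee(J')$.
   Context: All directed graphs are finite and simple. A reorientation of a directed acyclic graph $D=(V,A)$ is a directed graph with the same underlying undirected graph, encoded by the set of arcs of $D$ that it reverses. $\mathcal{AR}_D$ is the poset of acyclic reorientations of $D$ ordered by inclusion of sets of reversed arcs. The transitive reduction of a directed acyclic graph is obtained by deleting all arcs whose endpoints are connected by a directed path of length at least $2$. A directed graph is a forest if its underlying undirected graph has no cycle. $D$ is vertebrate if the transitive reduction of every induced subgraph of $D$ is a forest; filled if for any directed path $\pi$ in $D$ whose endpoints are joined by an arc of $D$, all arcs joining any two vertices of $\pi$ belong to $D$; skeletal if vertebrate and filled. When $D$ is skeletal, $\mathcal{AR}_D$ is a congruence uniform lattice. A congruence of a lattice is an equivalence relation compatible with meets and joins; $\mathrm{con}(x,y)$ is the minimal (finest) congruence with $x\equiv y$. A join irreducible $J$ covers a unique element $J_\star$. $J$ forces $J'$ if $\mathrm{con}(J'_\star,J')$ refines $\mathrm{con}(J_\star,J)$, i.e. if every congruence $\equiv$ with $J_\star\equiv J$ also satisfies $J'_\star\equiv J'$. The transitive support of an arc $(u,v)$ of $D$ is the set of vertices appearing along directed paths in $D$ from $u$ to $v$. A rope of $D$ is a quadruple $(u,v,\nabla,\Delta)$ where $(u,v)\in A$ and $\nabla\sqcup\Delta$ is a partition of the transitive support of $(u,v)$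 minus $\{u,v\}$. A rope $(u,v,\nabla,\Delta)$ is a subrope of a rope $(u',v',\nabla',\Delta')$ if $\{u,v\}\subseteq\{u',v'\}\cup\nabla'\cup\Delta'$, $\nabla\subseteq\nabla'$ and $\Delta\subseteq\Delta'$. For a join irreducible $J$ of $\mathcal{AR}_D$, there is a unique arc $(u,v)$ of $D$ that is reversed in the transitive reduction of $J$, and $\rho_\vee(J)$ is the rope $(u,v,\nabla,\Delta)$ with $\nabla=\{w\in V : (u,w)\in D\setminus J,\ (w,v)\in D\cap J\}$ and $\Delta=\{w\in V : (u,w)\in D\cap J,\ (w,v)\in D\setminus J\}$ (membership refers to arcs). *)

theory Defs
  imports "HOL-Algebra.Lattice"
begin

section \<open>Directed graphs\<close>

text \<open>
  A simple directed graph is a vertex set \<open>V\<close> together with an arc relation \<open>A\<close> on \<open>V\<close>.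
  Acyclicity of \<open>A\<close> excludes loops and antiparallel arcs.
\<close>

definition dag :: "'a set \<Rightarrow> 'a rel \<Rightarrow> bool" where
  "dag V A \<longleftrightarrow> finite V \<and> A \<subseteq> V \<times> V \<and> acyclic A"

text \<open>
  In an acyclic relation walks are paths, so \<^term>\<open>(u, v) \<in> A O A\<^sup>+\<close> says that there is a directed
  path of length at least 2 from \<open>u\<close> to \<open>v\<close>.
\<close>

definition transitive_reduction :: "'a rel \<Rightarrow> 'a rel" where
  "transitive_reduction A = A - A O A\<^sup>+"

text \<open>
  The cycles excluded here are those of the underlying simple undirected graph; hence they have at
  least three vertices.
\<close>

definition forest :: "'a rel \<Rightarrow> bool" where
  "forest A \<longleftrightarrow>
    \<not> (\<exists>c. length c \<ge> 3 \<and> distinct c \<and> successively (\<lambda>x y. (x, y) \<in> A \<union> A\<inverse>) c \<and>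
          (last c, hd c) \<in> A \<union> A\<inverse>)"

definition vertebrate :: "'a set \<Rightarrow> 'a rel \<Rightarrow> bool" where
  "vertebrate V A \<longleftrightarrow> (\<forall>U \<subseteq> V. forest (transitive_reduction (Restr A U)))"

definition directed_path :: "'a rel \<Rightarrow> 'a list \<Rightarrow> bool" where
  "directed_path A p \<longleftrightarrow> p \<noteq> [] \<and> distinct p \<and> successively (\<lambda>x y. (x, y) \<in> A) p"

text \<open>
  \<^const>\<open>sorted_wrt\<close> relates any two entries of the list, not just consecutive ones.  For acyclic
  \<open>A\<close>, an arc joining two vertices of a directed path can only point forward along that path.
\<close>

definition filled :: "'a rel \<Rightarrow> bool" where
  "filled A \<longleftrightarrow>
    (\<forall>p. directed_path A p \<and> (hd p, last p) \<in> A \<longrightarrow> sorted_wrt (\<lambda>x y. (x, y) \<in> A) p)"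

definition skeletal :: "'a set \<Rightarrow> 'a rel \<Rightarrow> bool" where
  "skeletal V A \<longleftrightarrow> vertebrate V A \<and> filled A"


section \<open>Acyclic reorientations\<close>

text \<open>The arcs of the reorientation of \<open>A\<close> that reverses exactly the arcs in \<open>X \<subseteq> A\<close>.\<close>

definition reorient :: "'a rel \<Rightarrow> 'a rel \<Rightarrow> 'a rel" where
  "reorient A X = (A - X) \<union> X\<inverse>"

definition acyclic_reorientations :: "'a rel \<Rightarrow> 'a rel gorder" where
  "acyclic_reorientations A =
    \<lparr>carrier = {X. X \<subseteq> A \<and> acyclic (reorient A X)}, eq = (=), le = (\<subseteq>)\<rparr>"


section \<open>Lattice congruences and forcing\<close>

definition covers :: "('b, 'c) gorder_scheme \<Rightarrow> 'b \<Rightarrow> 'b \<Rightarrow> bool" where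
  "covers L x y \<longleftrightarrow>
    x \<in> carrier L \<and> y \<in> carrier L \<and> y \<sqsubset>\<^bsub>L\<^esub> x \<and>
    \<not> (\<exists>z \<in> carrier L. y \<sqsubset>\<^bsub>L\<^esub> z \<and> z \<sqsubset>\<^bsub>L\<^esub> x)"

definition join_irreducible :: "('b, 'c) gorder_scheme \<Rightarrow> 'b \<Rightarrow> bool" where
  "join_irreducible L j \<longleftrightarrow> j \<in> carrier L \<and> (\<exists>!x. covers L j x)"

definition lower_cover :: "('b, 'c) gorder_scheme \<Rightarrow> 'b \<Rightarrow> 'b" where
  "lower_cover L j = (THE x. covers L j x)"

definition lattice_congruence :: "('b, 'c) gorder_scheme \<Rightarrow> 'b rel \<Rightarrow> bool" where
  "lattice_congruence L R \<longleftrightarrow>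
    equiv (carrier L) R \<and>
    (\<forall>x x' y y'. (x, x') \<in> R \<and> (y, y') \<in> R \<longrightarrow>
      (x \<squnion>\<^bsub>L\<^esub> y, x' \<squnion>\<^bsub>L\<^esub> y') \<in> R \<and> (x \<sqinter>\<^bsub>L\<^esub> y, x' \<sqinter>\<^bsub>L\<^esub> y') \<in> R)"

text \<open>Congruences are closed under intersection, so this is the finest one identifying \<open>x\<close> and \<open>y\<close>.\<close>

definition con :: "('b, 'c) gorder_scheme \<Rightarrow> 'b \<Rightarrow> 'b \<Rightarrow> 'b rel" where
  "con L x y = \<Inter> {R. lattice_congruence L R \<and> (x, y) \<in> R}"

definition forces :: "('b, 'c) gorder_scheme \<Rightarrow> 'b \<Rightarrow> 'b \<Rightarrow> bool" where
  "forces L j j' \<longleftrightarrow> con L (lower_cover L j') j' \<subseteq> con L (lower_cover L j) j"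


section \<open>Ropes\<close>

text \<open>Again, \<open>A\<close> is acyclic, so walks, as described by \<open>A\<^sup>*\<close>, are paths.\<close>

definition transitive_support :: "'a rel \<Rightarrow> 'a \<Rightarrow> 'a \<Rightarrow> 'a set" where
  "transitive_support A u v = {w. (u, w) \<in> A\<^sup>* \<and> (w, v) \<in> A\<^sup>*}"

type_synonym 'a rope = "'a \<times> 'a \<times> 'a set \<times> 'a set"

definition ropes :: "'a rel \<Rightarrow> 'a rope set" where
  "ropes A = {(u, v, N, D) | u v N D.
    (u, v) \<in> A \<and> N \<union> D = transitive_support A u v - {u, v} \<and> N \<inter> D = {}}"

definition subrope :: "'a rel \<Rightarrow> 'a rope \<Rightarrow> 'a rope \<Rightarrow> bool" where
  "subrope A r r' \<longleftrightarrow>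
    r \<in> ropes A \<and> r' \<in> ropes A \<and>
    (case (r, r') of ((u, v, N, D), (u', v', N', D')) \<Rightarrow>
      {u, v} \<subseteq> {u', v'} \<union> N' \<union> D' \<and> N \<subseteq> N' \<and> D \<subseteq> D')"

text \<open>
  \<open>J\<close> is the set of reversed arcs of a join irreducible acyclic reorientation; there is then a
  unique arc of \<open>A\<close> whose reversal lies in the transitive reduction of that reorientation.
\<close>

definition reversed_arc :: "'a rel \<Rightarrow> 'a rel \<Rightarrow> 'a \<times> 'a" where
  "reversed_arc A J =
    (THE (u, v). (u, v) \<in> A \<and> (v, u) \<in> transitive_reduction (reorient A J))"

definition rope_of :: "'a rel \<Rightarrow> 'a rel \<Rightarrow> 'a rope" where
  "rope_of A J =
    (let (u, v) = reversed_arc A J; B = reorient A J in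
      (u, v,
       {w. (u, w) \<in> A - B \<and> (w, v) \<in> A \<inter> B},
       {w. (u, w) \<in> A \<inter> B \<and> (w, v) \<in> A - B}))"

end

theory Submission
  imports Defs
begin

text \<open>
  The vertices on the directed paths joining the ends of an arc form a clique, and the underlying
  graph is chordal.  So a set of reversed arcs is acyclic iff it satisfies a closure and a coclosure
  condition on each triangle, and joins are transitive closures, as for inversion sets of
  permutations.  The join irreducible of a rope \<open>(u, v, N, D)\<close> reverses the arcs from \<open>{u} \<union> D\<close> to
  \<open>{v} \<union> N\<close>; its lower cover lacks the arc \<open>(u, v)\<close> only.

  If a rope is a subrope of another one, joining its join irreducible with two shorter ropes, one on
  each side of it, and then meeting with the larger join irreducible transports the collapse.
  Conversely, for a set \<open>U\<close> of ropes that contains the subropes of its members, having the same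
  join irreducibles from \<open>U\<close> below is the same as having the same meet irreducibles from \<open>U\<close> above.
  The first description is compatible with meets and the second one with joins, so this is a
  congruence.  Taking for \<open>U\<close> all ropes that do not have a given rope as a subrope gives a congruence
  that collapses the join irreducible of this rope and none of those from \<open>U\<close>.
\<close>

section \<open>Directed paths, cycles and transitive reductions\<close>

lemma successively_imp_directed_path:
  assumes "acyclic R" "p \<noteq> []" "successively (\<lambda>x y. (x, y) \<in> R) p"
  shows "directed_path R p"
proof -
  have "successively (\<lambda>x y. (x, y) \<in> R\<^sup>+) p"
    using assms(3) by (rule successively_mono) auto
  then have "sorted_wrt (\<lambda>x y. (x, y) \<in> R\<^sup>+) p"
    by (subst (asm) successively_iff_sorted_wrt_strong) (auto intro: trancl_trans)
  then have "distinct p"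
    using assms(1) by (induction p) (auto simp: acyclic_def)
  then show ?thesis using assms(2,3) by (auto simp: directed_path_def)
qed

lemma directed_path_of_trancl:
  assumes "acyclic R" "(a, b) \<in> R\<^sup>+"
  shows "\<exists>p. directed_path R p \<and> hd p = a \<and> last p = b \<and> length p \<ge> 2"
proof -
  have "\<exists>p. successively (\<lambda>x y. (x, y) \<in> R) p \<and> hd p = a \<and> last p = b \<and> length p \<ge> 2"
    using assms(2)
  proof (induction rule: converse_trancl_induct)
    case (base y)
    then show ?case by (intro exI[of _ "[y, b]"]) auto
  next
    case (step y z)
    then obtain p where p: "successively (\<lambda>x y. (x, y) \<in> R) p" "hd p = z" "last p = b" "length p \<ge> 2"
      by blast
    then show ?case using step(1)
      by (intro exI[of _ "y # p"]) (cases p; auto)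
  qed
  then obtain p where p: "successively (\<lambda>x y. (x, y) \<in> R) p" "hd p = a" "last p = b" "length p \<ge> 2"
    by blast
  moreover have "p \<noteq> []" using p(4) by auto
  ultimately show ?thesis using successively_imp_directed_path assms(1) by blast
qed

text \<open>Induction on the number of vertices strictly between \<open>a\<close> and
  \<open>b\<close>. With none, \<open>(a, b)\<close> is an arc that the reduction keeps. Otherwise
  split at some \<open>w\<close>, which by acyclicity is missing from both smaller
  intervals.\<close>

lemma trancl_transitive_reduction:
  assumes "finite R" "acyclic R"
  shows "(a, b) \<in> R\<^sup>+ \<Longrightarrow> (a, b) \<in> (transitive_reduction R)\<^sup>+"
proof (induction "card {w. (a, w) \<in> R\<^sup>+ \<and> (w, b) \<in> R\<^sup>+}" arbitrary: a b rule: less_induct)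
  case less
  let ?I = "\<lambda>a b. {w. (a, w) \<in> R\<^sup>+ \<and> (w, b) \<in> R\<^sup>+}"
  have fin: "finite (?I a b)"
  proof (rule finite_subset)
    show "?I a b \<subseteq> snd ` (R\<^sup>+)" by force
  qed (use assms(1) in \<open>simp add: finite_trancl\<close>)
  show ?case
  proof (cases "?I a b = {}")
    case True
    obtain z where z: "(a, z) \<in> R" "(z, b) \<in> R\<^sup>*" using tranclD[OF less(2)] by blast
    then have "(a, b) \<in> R" using True by (auto simp: rtrancl_eq_or_trancl)
    moreover have "(a, b) \<notin> R O R\<^sup>+" using True by auto
    ultimately show ?thesis by (auto simp: transitive_reduction_def)
  next
    case False
    then obtain w where w: "(a, w) \<in> R\<^sup>+" "(w, b) \<in> R\<^sup>+" by blast
    have nw: "(w, w) \<notin> R\<^sup>+" using assms(2) by (auto simp: acyclic_def)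
    have "?I a w \<subset> ?I a b" "?I w b \<subset> ?I a b" using w nw by (auto intro: trancl_trans)
    then have "card (?I a w) < card (?I a b)" "card (?I w b) < card (?I a b)"
      using fin by (auto intro: psubset_card_mono)
    then show ?thesis using less(1) w by (meson trancl_trans)
  qed
qed

text \<open>A shortest closed walk is a cycle without chords, since a chord or a repeated vertex
  would give a shorter closed walk. The exception for \<open>i = 0\<close> is the closing
  arc.\<close>

lemma acyclic_if_no_chordless_cycle:
  assumes irr: "\<And>x. (x, x) \<notin> B"
    and no_chordless: "\<And>c. \<lbrakk>length c \<ge> 2; distinct c; successively (\<lambda>x y. (x, y) \<in> B) c;
          (last c, hd c) \<in> B;
          \<And>i j. \<lbrakk>i < j; j < length c; (c ! i, c ! j) \<in> B \<union> B\<inverse>\<rbrakk>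
            \<Longrightarrow> j = Suc i \<or> i = 0 \<and> Suc j = length c\<rbrakk> \<Longrightarrow> False"
  shows "acyclic B"
proof (rule ccontr)
  assume "\<not> acyclic B"
  define cyc where
    "cyc c \<longleftrightarrow> c \<noteq> [] \<and> successively (\<lambda>x y. (x, y) \<in> B) c \<and> (last c, hd c) \<in> B" for c
  obtain x where "(x, x) \<in> B\<^sup>+" using \<open>\<not> acyclic B\<close> by (auto simp: acyclic_def)
  then obtain z where "(x, z) \<in> B\<^sup>*" "(z, x) \<in> B" by (meson tranclD2)
  have "\<exists>c. c \<noteq> [] \<and> hd c = x \<and> last c = z \<and> successively (\<lambda>x y. (x, y) \<in> B) c"
    using \<open>(x, z) \<in> B\<^sup>*\<close>
  proof (induction rule: converse_rtrancl_induct)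
    case base
    then show ?case by (intro exI[of _ "[z]"]) auto
  next
    case (step y w)
    then obtain c where "c \<noteq> []" "hd c = w" "last c = z" "successively (\<lambda>x y. (x, y) \<in> B) c"
      by blast
    then show ?case using step(1) by (intro exI[of _ "y # c"]) (cases c; auto)
  qed
  then have "\<exists>c. cyc c" using \<open>(z, x) \<in> B\<close> unfolding cyc_def by blast
  then obtain c where c: "cyc c" and min: "\<And>d. cyc d \<Longrightarrow> length c \<le> length d"
    using ex_has_least_nat[of cyc _ length] by blast
  let ?n = "length c"
  have c': "c \<noteq> []" "successively (\<lambda>x y. (x, y) \<in> B) c" "(last c, hd c) \<in> B"
    using c by (auto simp: cyc_def)
  have step: "(c ! i, c ! Suc i) \<in> B" if "Suc i < ?n" for i
    using c'(2) that by (simp add: successively_conv_nth)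
  \<comment> \<open>A forward chord lets the walk skip everything strictly between positions
    \<open>i\<close> and \<open>j\<close>.\<close>
  have fwd: "j = Suc i" if "i < j" "j < ?n" "(c ! i, c ! j) \<in> B" for i j
  proof -
    have "successively (\<lambda>x y. (x, y) \<in> B) (take (Suc i) c)"
      "successively (\<lambda>x y. (x, y) \<in> B) (drop j c)"
      using step that by (auto simp: successively_conv_nth)
    moreover have "last (take (Suc i) c) = c ! i"
      using that by (simp add: take_Suc_conv_app_nth)
    moreover have "hd (drop j c) = c ! j" "hd (take (Suc i) c) = hd c" "last (drop j c) = last c"
      using that by (simp_all add: hd_drop_conv_nth)
    ultimately have "cyc (take (Suc i) c @ drop j c)"
      unfolding cyc_def using that c' by (simp add: successively_append_iff)
    from min[OF this] that show ?thesis by simp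
  qed
  \<comment> \<open>A backward arc closes the segment from \<open>i\<close> to \<open>j\<close>,
    which must then be all of \<open>c\<close>. The case \<open>i = j\<close> is allowed because a
    repetition at neighbouring positions leads to it.\<close>
  have bwd: "i = 0 \<and> Suc j = ?n" if "i \<le> j" "j < ?n" "(c ! j, c ! i) \<in> B" for i j
  proof -
    let ?d = "drop i (take (Suc j) c)"
    have "successively (\<lambda>x y. (x, y) \<in> B) ?d"
      using step that by (auto simp: successively_conv_nth)
    moreover have "last ?d = c ! j"
      using that by (simp add: take_Suc_conv_app_nth)
    moreover have "hd ?d = c ! i"
      using that by (simp add: hd_drop_conv_nth)
    ultimately have "cyc ?d"
      unfolding cyc_def using that by simp
    from min[OF this] that have "?n \<le> Suc j - i" by simp
    then show ?thesis using that by auto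
  qed
  have "c ! i \<noteq> c ! j" if ij: "i < j" "j < ?n" for i j
  proof
    assume eq: "c ! i = c ! j"
    obtain k where k: "j = Suc k" using ij by (cases j) auto
    then have "(c ! k, c ! i) \<in> B" using step[of k] that eq by simp
    then show False using bwd[of i k] that k by simp
  qed
  then have "distinct c" by (metis distinct_conv_nth linorder_neqE_nat)
  moreover have "?n \<ge> 2"
  proof (rule ccontr)
    assume "\<not> ?n \<ge> 2"
    then obtain x where "c = [x]" using c'(1) by (cases c) (auto simp: not_le less_Suc_eq)
    then show False using c'(3) irr by simp
  qed
  ultimately show False
    using no_chordless[of c] c' fwd bwd by (metis UnE converseD less_imp_le)
qed

section \<open>Skeletal graphs\<close>

locale skeletal_dag =
  fixes V :: "'a set" and A :: "'a rel"
  assumes dag: "dag V A" and skel: "skeletal V A"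
begin

lemma A_subset: "A \<subseteq> V \<times> V"
  and finite_A: "finite A"
  and acyclic_A: "acyclic A"
  using dag by (auto simp: dag_def intro: finite_subset)

lemma no_cycle: "(x, x) \<notin> A\<^sup>+"
  using acyclic_A by (auto simp: acyclic_def)

lemma irrefl_A: "(x, x) \<notin> A"
  using no_cycle by blast

lemma antisym_A: "(x, y) \<in> A \<Longrightarrow> (y, x) \<notin> A"
  using no_cycle by (meson r_into_trancl' trancl_trans)

text \<open>Two paths joined at \<open>w\<close> form one path whose ends are joined by an arc, so
  filledness applies to it.\<close>

lemma arcs_through:
  assumes "(a, b) \<in> A" "(a, w) \<in> A\<^sup>+" "(w, b) \<in> A\<^sup>+"
  shows "(a, w) \<in> A" "(w, b) \<in> A"
proof -
  obtain p where p: "directed_path A p" "hd p = a" "last p = w" "length p \<ge> 2"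
    using directed_path_of_trancl[OF acyclic_A assms(2)] by blast
  obtain q where q: "directed_path A q" "hd q = w" "last q = b" "length q \<ge> 2"
    using directed_path_of_trancl[OF acyclic_A assms(3)] by blast
  obtain q' where q': "q = w # q'" "q' \<noteq> []"
    using q by (cases q; cases "tl q") (auto simp: directed_path_def)
  obtain p' where p': "p = a # p'" "p' \<noteq> []"
    using p by (cases p; cases "tl p") (auto simp: directed_path_def)
  let ?r = "p @ q'"
  have s: "successively (\<lambda>x y. (x, y) \<in> A) ?r"
    using p q q' by (auto simp: directed_path_def successively_append_iff successively_Cons)
  have "directed_path A ?r" using successively_imp_directed_path[OF acyclic_A _ s] p' by simp
  moreover have "(hd ?r, last ?r) \<in> A" using p p' q q' assms(1) by auto
  ultimately have "sorted_wrt (\<lambda>x y. (x, y) \<in> A) ?r"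
    using skel by (auto simp: skeletal_def filled_def)
  moreover have "w \<in> set p'" using p' p(3) by auto
  moreover have "b \<in> set q'" using q' q(3) by auto
  moreover have "w \<in> set p" using p' \<open>w \<in> set p'\<close> by auto
  ultimately show "(a, w) \<in> A" "(w, b) \<in> A"
    by (auto simp: p' sorted_wrt_append)
qed

definition between :: "'a \<Rightarrow> 'a \<Rightarrow> 'a set" where
  "between u v = {w. (u, w) \<in> A \<and> (w, v) \<in> A}"

lemma transitive_support_eq:
  assumes "(u, v) \<in> A"
  shows "transitive_support A u v = between u v \<union> {u, v}"
  using arcs_through[OF assms] assms
  by (auto simp: transitive_support_def between_def rtrancl_eq_or_trancl)

text \<open>If \<open>w\<close> and \<open>x\<close> were not adjacent, the reduction of the
  subgraph induced on the four vertices would still contain all arcs except \<open>(u, v)\<close>,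
  hence the 4-cycle \<open>u, w, v, x\<close>, which vertebrate graphs exclude.\<close>

lemma between_adjacent:
  assumes uv: "(u, v) \<in> A" and w: "w \<in> between u v" and x: "x \<in> between u v"
  shows "w = x \<or> (w, x) \<in> A \<or> (x, w) \<in> A"
proof (rule ccontr)
  assume na: "\<not> ?thesis"
  define R where "R = Restr A {u, v, w, x}"
  have arcs: "(u, w) \<in> A" "(w, v) \<in> A" "(u, x) \<in> A" "(x, v) \<in> A"
    using w x by (auto simp: between_def)
  have R: "R = {(u, v), (u, w), (w, v), (u, x), (x, v)}"
    using na arcs uv antisym_A irrefl_A unfolding R_def by blast
  have dist: "u \<noteq> v" "u \<noteq> w" "u \<noteq> x" "w \<noteq> v" "x \<noteq> v" "w \<noteq> x"
    using arcs uv irrefl_A na by auto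
  have "(a, b) \<in> transitive_reduction R"
    if "(a, b) \<in> {(u, w), (w, v), (u, x), (x, v)}" for a b
  proof -
    have "\<not> ((a, y) \<in> R \<and> (y, b) \<in> R\<^sup>+)" for y
    proof
      assume y: "(a, y) \<in> R \<and> (y, b) \<in> R\<^sup>+"
      then obtain z where z: "(y, z) \<in> R\<^sup>*" "(z, b) \<in> R" by (meson tranclD2)
      have "(a, z) \<in> R\<^sup>+" using y z(1) by auto
      moreover have "R\<^sup>+ \<subseteq> A\<^sup>+" by (rule trancl_mono_subset) (auto simp: R_def)
      ultimately have az: "(a, z) \<in> A\<^sup>+" by blast
      have "a = u \<and> (b = w \<or> b = x) \<or> (a = w \<or> a = x) \<and> b = v"
        using that by auto
      then show False
      proof
        assume "a = u \<and> (b = w \<or> b = x)"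
        then have "z = u" using z(2) dist by (auto simp: R)
        then show False using az \<open>a = u \<and> _\<close> no_cycle by simp
      next
        assume a: "(a = w \<or> a = x) \<and> b = v"
        then have "y = v" using y dist by (auto simp: R)
        then have "(v, v) \<in> R\<^sup>+" using y a by simp
        then show False using no_cycle \<open>R\<^sup>+ \<subseteq> A\<^sup>+\<close> by blast
      qed
    qed
    then show ?thesis using that by (auto simp: transitive_reduction_def R)
  qed
  then have "{(u, w), (w, v), (u, x), (x, v)} \<subseteq> transitive_reduction R"
    by auto
  then have "\<not> forest (transitive_reduction R)"
    unfolding forest_def not_not using dist by (intro exI[of _ "[u, w, v, x]"]) auto
  moreover have "{u, v, w, x} \<subseteq> V" using arcs A_subset by auto
  ultimately show False
    using skel unfolding skeletal_def vertebrate_def R_def by blast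
qed

text \<open>This is chordality. The subgraph induced on a long chordless cycle has no triangles, so
  by filledness its transitive reduction deletes nothing and keeps the cycle.\<close>

lemma adjacent_chordless:
  assumes c: "length c \<ge> 4" "distinct c" "successively (\<lambda>x y. (x, y) \<in> A \<union> A\<inverse>) c"
      "(last c, hd c) \<in> A \<union> A\<inverse>"
    and chordless: "\<And>i j. \<lbrakk>i < j; j < length c; (c ! i, c ! j) \<in> A \<union> A\<inverse>\<rbrakk>
        \<Longrightarrow> j = Suc i \<or> i = 0 \<and> Suc j = length c"
  shows False
proof -
  \<comment> \<open>Adjacent vertices sit at cyclically consecutive positions, and three positions
    cannot be pairwise consecutive on a cycle of length at least 4.\<close>
  have no_triangle: False
    if "{x, y, z} \<subseteq> set c" "(x, y) \<in> A" "(y, z) \<in> A" "(x, z) \<in> A" for x y z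
  proof -
    have "x \<in> set c" "y \<in> set c" "z \<in> set c" using that(1) by auto
    then obtain i j k where ijk: "i < length c" "j < length c" "k < length c"
      "c ! i = x" "c ! j = y" "c ! k = z"
      unfolding in_set_conv_nth by blast
    have adj: "q = Suc p \<or> p = Suc q \<or> p = 0 \<and> Suc q = length c \<or> q = 0 \<and> Suc p = length c"
      if "p < length c" "q < length c" "(c ! p, c ! q) \<in> A" for p q
      using that irrefl_A chordless[of p q] chordless[of q p]
      by (cases p q rule: linorder_cases) auto
    have "i \<noteq> j" "j \<noteq> k" "i \<noteq> k" using that irrefl_A ijk by auto
    then show False
      using adj[of i j] adj[of j k] adj[of i k] ijk that c(1) by auto
  qed
  define R where "R = Restr A (set c)"
  have "transitive_reduction R = R"
  proof -
    have "\<not> ((a, y) \<in> R \<and> (y, b) \<in> R\<^sup>+)" if "(a, b) \<in> R" for a b y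
    proof
      assume y: "(a, y) \<in> R \<and> (y, b) \<in> R\<^sup>+"
      have "R\<^sup>+ \<subseteq> A\<^sup>+" by (rule trancl_mono_subset) (auto simp: R_def)
      then have "(y, b) \<in> A\<^sup>+" using y by blast
      then have "(y, b) \<in> A" using arcs_through[of a b y] that y by (auto simp: R_def)
      then show False using no_triangle[of a y b] that y by (auto simp: R_def)
    qed
    then show ?thesis by (auto simp: transitive_reduction_def)
  qed
  moreover have "successively (\<lambda>x y. (x, y) \<in> R \<union> R\<inverse>) c"
    using c(3) by (auto simp: successively_conv_nth R_def)
  moreover have "(last c, hd c) \<in> R \<union> R\<inverse>"
    using c(1,4) by (cases c) (auto simp: R_def)
  ultimately have "\<not> forest (transitive_reduction R)"
    unfolding forest_def not_not using c(1,2) by (intro exI[of _ c]) auto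
  moreover have "set c \<subseteq> V"
  proof
    fix x
    assume "x \<in> set c"
    then obtain i where i: "i < length c" "c ! i = x" by (auto simp: in_set_conv_nth)
    show "x \<in> V"
    proof (cases i)
      case 0
      then have "hd c = x" using i c(1) by (cases c) auto
      then show ?thesis using c(4) A_subset by auto
    next
      case (Suc k)
      then show ?thesis using c(3) i A_subset by (auto simp: successively_conv_nth)
    qed
  qed
  ultimately show False
    using skel unfolding skeletal_def vertebrate_def R_def by blast
qed

section \<open>The lattice of acyclic reorientations\<close>

text \<open>The two conditions say that no transitive triangle of \<open>A\<close> turns into a
  directed cycle when \<open>X\<close> is reversed.\<close>

definition biclosed :: "'a rel \<Rightarrow> bool" where
  "biclosed X \<longleftrightarrow> X \<subseteq> A \<and>
    (\<forall>a b c. (a, b) \<in> A \<and> (b, c) \<in> A \<and> (a, c) \<in> A \<longrightarrow>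
      ((a, b) \<in> X \<and> (b, c) \<in> X \<longrightarrow> (a, c) \<in> X) \<and>
      ((a, c) \<in> X \<longrightarrow> (a, b) \<in> X \<or> (b, c) \<in> X))"

lemma biclosedI:
  assumes "X \<subseteq> A"
    and "\<And>a b c. \<lbrakk>(a, b) \<in> A; (b, c) \<in> A; (a, c) \<in> A; (a, b) \<in> X; (b, c) \<in> X\<rbrakk> \<Longrightarrow> (a, c) \<in> X"
    and "\<And>a b c. \<lbrakk>(a, b) \<in> A; (b, c) \<in> A; (a, c) \<in> X; (a, b) \<notin> X\<rbrakk> \<Longrightarrow> (b, c) \<in> X"
  shows "biclosed X"
  using assms unfolding biclosed_def by blast

lemma biclosed_subset: "biclosed X \<Longrightarrow> X \<subseteq> A"
  by (auto simp: biclosed_def)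

lemma biclosed_closed:
  "\<lbrakk>biclosed X; (a, b) \<in> X; (b, c) \<in> X; (a, c) \<in> A\<rbrakk> \<Longrightarrow> (a, c) \<in> X"
  unfolding biclosed_def by blast

lemma biclosed_coclosed:
  "\<lbrakk>biclosed X; (a, c) \<in> X; (a, b) \<in> A; (b, c) \<in> A\<rbrakk> \<Longrightarrow> (a, b) \<in> X \<or> (b, c) \<in> X"
  unfolding biclosed_def by blast

lemma biclosed_complement: "biclosed X \<Longrightarrow> biclosed (A - X)"
  unfolding biclosed_def by blast

lemma reorient_symcl: "X \<subseteq> A \<Longrightarrow> reorient A X \<union> (reorient A X)\<inverse> = A \<union> A\<inverse>"
  by (auto simp: reorient_def)

text \<open>
  A shortest directed cycle of a reorientation is chordless, so it must be a triangle: the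
  underlying graph of a skeletal graph is chordal.
\<close>

lemma acyclic_reorient_iff:
  assumes "X \<subseteq> A"
  shows "acyclic (reorient A X) \<longleftrightarrow> biclosed X"
proof
  assume ac: "acyclic (reorient A X)"
  have no3: False
    if "(x, y) \<in> reorient A X" "(y, z) \<in> reorient A X" "(z, x) \<in> reorient A X" for x y z
  proof -
    have "(x, x) \<in> (reorient A X)\<^sup>+" using that by (meson r_into_trancl' trancl_trans)
    then show False using ac by (auto simp: acyclic_def)
  qed
  show "biclosed X"
  proof (rule biclosedI[OF assms])
    fix a b c
    assume "(a, b) \<in> A" "(b, c) \<in> A" "(a, c) \<in> A" "(a, b) \<in> X" "(b, c) \<in> X"
    then show "(a, c) \<in> X" using no3[of c b a] by (auto simp: reorient_def)
  next
    fix a b c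
    assume "(a, b) \<in> A" "(b, c) \<in> A" "(a, c) \<in> X" "(a, b) \<notin> X"
    then show "(b, c) \<in> X" using no3[of a b c] by (auto simp: reorient_def)
  qed
next
  assume bi: "biclosed X"
  let ?B = "reorient A X"
  have anti: "(y, x) \<notin> ?B" if "(x, y) \<in> ?B" for x y
    using that assms antisym_A by (auto simp: reorient_def)
  show "acyclic ?B"
  proof (rule acyclic_if_no_chordless_cycle)
    show "(x, x) \<notin> ?B" for x using anti by blast
  next
    fix c
    assume c: "length c \<ge> 2" "distinct c" "successively (\<lambda>x y. (x, y) \<in> ?B) c"
        "(last c, hd c) \<in> ?B"
      and chordless: "\<And>i j. \<lbrakk>i < j; j < length c; (c ! i, c ! j) \<in> ?B \<union> ?B\<inverse>\<rbrakk>
        \<Longrightarrow> j = Suc i \<or> i = 0 \<and> Suc j = length c"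
    consider "length c = 2" | "length c = 3" | "length c \<ge> 4" using c(1) by linarith
    then show False
    proof cases
      case 1
      then obtain x y where "c = [x, y]" by (auto simp: numeral_eq_Suc length_Suc_conv)
      then show False using c anti by auto
    next
      case 2
      then obtain x y z where "c = [x, y, z]" by (auto simp: numeral_eq_Suc length_Suc_conv)
      then have xyz: "(x, y) \<in> ?B" "(y, z) \<in> ?B" "(z, x) \<in> ?B" using c by auto
      \<comment> \<open>Since \<open>A\<close> is acyclic, the triangle is transitive in
        \<open>A\<close>, so one of the two conditions of \<open>biclosed\<close> applies.\<close>
      have "(x, x) \<notin> A\<^sup>+" "(x, x) \<notin> (A\<inverse>)\<^sup>+" using no_cycle by (auto simp: trancl_converse)
      then have "\<not> ((x, y) \<in> A \<and> (y, z) \<in> A \<and> (z, x) \<in> A)"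
        "\<not> ((x, y) \<in> A\<inverse> \<and> (y, z) \<in> A\<inverse> \<and> (z, x) \<in> A\<inverse>)"
        by (meson r_into_trancl' trancl_trans)+
      then show False
        using xyz bi antisym_A unfolding biclosed_def reorient_def by blast
    next
      case 3
      have sub: "?B \<subseteq> A \<union> A\<inverse>" using reorient_symcl[OF assms] by blast
      show False
      proof (rule adjacent_chordless[OF 3 c(2)])
        show "successively (\<lambda>x y. (x, y) \<in> A \<union> A\<inverse>) c"
          using c(3) by (rule successively_mono) (use sub in blast)
        show "(last c, hd c) \<in> A \<union> A\<inverse>" using c(4) sub by blast
      qed (use chordless reorient_symcl[OF assms] in blast)
    qed
  qed
qed

abbreviation "L \<equiv> acyclic_reorientations A"

lemma carrier_L [simp]: "X \<in> carrier L \<longleftrightarrow> biclosed X"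
  using acyclic_reorient_iff biclosed_subset by (auto simp: acyclic_reorientations_def)

lemma le_L [simp]: "X \<sqsubseteq>\<^bsub>L\<^esub> Y \<longleftrightarrow> X \<subseteq> Y"
  and eq_L [simp]: "X .=\<^bsub>L\<^esub> Y \<longleftrightarrow> X = Y"
  by (auto simp: acyclic_reorientations_def)

lemma lless_L [simp]: "X \<sqsubset>\<^bsub>L\<^esub> Y \<longleftrightarrow> X \<subset> Y"
  by (auto simp: lless_def)

text \<open>Only coclosure needs work. Follow a walk in \<open>X \<union> Y\<close> from
  \<open>a\<close> to \<open>c\<close>: its second vertex \<open>z\<close> and the given
  \<open>b\<close> both lie between the ends, hence are comparable. If \<open>b\<close> comes before
  \<open>z\<close>, coclosure applies to the first arc; if after, induction applies to the rest of
  the walk.\<close>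

lemma biclosed_closure:
  assumes X: "biclosed X" and Y: "biclosed Y"
  shows "biclosed ((X \<union> Y)\<^sup>+ \<inter> A)"
proof -
  let ?Z = "X \<union> Y"
  have ZA: "?Z\<^sup>+ \<subseteq> A\<^sup>+"
    by (rule trancl_mono_subset) (use X Y biclosed_subset in auto)
  have co: "(a, b) \<in> ?Z \<or> (b, c) \<in> ?Z" if "(a, c) \<in> ?Z" "(a, b) \<in> A" "(b, c) \<in> A" for a b c
    using that X Y biclosed_coclosed by blast
  have "(a, b) \<in> ?Z\<^sup>+ \<or> (b, c) \<in> ?Z\<^sup>+"
    if "(a, c) \<in> ?Z\<^sup>+" "(a, c) \<in> A" "(a, b) \<in> A" "(b, c) \<in> A" for a b c
    using that
  proof (induction rule: converse_trancl_induct)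
    case (base y)
    then show ?case using co by blast
  next
    case (step y z)
    then have arcs: "(y, z) \<in> A" "(z, c) \<in> A"
      using X Y biclosed_subset ZA arcs_through(2)[of y c z] by blast+
    consider "b = z" | "(b, z) \<in> A" | "(z, b) \<in> A"
      using between_adjacent[of y c b z] step.prems arcs by (auto simp: between_def)
    then show ?case
    proof cases
      case 1
      then show ?thesis using step by auto
    next
      case 2
      then have "(y, b) \<in> ?Z \<or> (b, z) \<in> ?Z" using co step by blast
      then show ?thesis using step.hyps(2) by (meson r_into_trancl' trancl_into_trancl2)
    next
      case 3
      then have "(z, b) \<in> ?Z\<^sup>+ \<or> (b, c) \<in> ?Z\<^sup>+" using step.IH arcs step.prems by blast
      then show ?thesis using step.hyps(1) by (meson trancl_into_trancl2)
    qed
  qed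
  then show ?thesis
    unfolding biclosed_def by (auto intro: trancl_trans)
qed

text \<open>The walk is contracted from its far end; filledness supplies the arc from each
  intermediate vertex to \<open>b\<close>.\<close>

lemma closure_least:
  assumes M: "biclosed M" "X \<subseteq> M"
  shows "X\<^sup>+ \<inter> A \<subseteq> M"
proof -
  have XA: "X\<^sup>+ \<subseteq> A\<^sup>+"
    by (rule trancl_mono_subset) (use M biclosed_subset in auto)
  have "(a, b) \<in> M" if "(a, b) \<in> X\<^sup>+" "(a, b) \<in> A" for a b
    using that
  proof (induction rule: converse_trancl_induct)
    case (base y)
    then show ?case using M by auto
  next
    case (step y z)
    then have "(y, z) \<in> A" "(z, b) \<in> A\<^sup>+" using M biclosed_subset XA by blast+
    then have "(z, b) \<in> A" using arcs_through(2)[of y b z] step.prems by blast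
    then show ?case using step M biclosed_closed by blast
  qed
  then show ?thesis by auto
qed

text \<open>Joins are the closures above. Complementation in \<open>A\<close> reverses inclusion and
  preserves \<open>biclosed\<close>, which yields the meets.\<close>

lemma lattice_L: "lattice L"
proof unfold_locales
  fix X Y
  assume "X \<in> carrier L" "Y \<in> carrier L"
  then have XY: "biclosed X" "biclosed Y" by auto
  show "\<exists>s. is_lub L s {X, Y}"
  proof (intro exI[of _ "(X \<union> Y)\<^sup>+ \<inter> A"] least_UpperI)
    show "(X \<union> Y)\<^sup>+ \<inter> A \<sqsubseteq>\<^bsub>L\<^esub> M" if "M \<in> Upper L {X, Y}" for M
      using that XY closure_least[of M "X \<union> Y"] by (auto simp: Upper_def)
  qed (use XY biclosed_subset biclosed_closure in \<open>auto\<close>)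
  have XY': "biclosed (A - X)" "biclosed (A - Y)" using XY biclosed_complement by auto
  let ?C = "((A - X) \<union> (A - Y))\<^sup>+ \<inter> A"
  show "\<exists>s. is_glb L s {X, Y}"
  proof (intro exI[of _ "A - ?C"] greatest_LowerI)
    show "M \<sqsubseteq>\<^bsub>L\<^esub> A - ?C" if "M \<in> Lower L {X, Y}" for M
    proof -
      have M: "biclosed M" "M \<subseteq> X" "M \<subseteq> Y" using that XY by (auto simp: Lower_def)
      then have "?C \<subseteq> A - M"
        using closure_least[of "A - M" "(A - X) \<union> (A - Y)"] biclosed_complement by auto
      then show ?thesis using M(2) XY(1) biclosed_subset by auto
    qed
    show "A - ?C \<in> carrier L"
      using biclosed_closure[OF XY'] biclosed_complement by simp
  qed (use XY biclosed_subset in \<open>auto\<close>)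
qed (auto simp: acyclic_reorientations_def)

section \<open>Ropes and their join irreducibles\<close>

lemma ropes_iff:
  "(u, v, N, D) \<in> ropes A \<longleftrightarrow> (u, v) \<in> A \<and> N \<union> D = between u v \<and> N \<inter> D = {}"
proof (cases "(u, v) \<in> A")
  case True
  then have "transitive_support A u v - {u, v} = between u v"
    using transitive_support_eq[OF True] irrefl_A by (auto simp: between_def)
  then show ?thesis using True by (auto simp: ropes_def)
qed (auto simp: ropes_def)

lemma ropes_swap: "(u, v, N, D) \<in> ropes A \<longleftrightarrow> (u, v, D, N) \<in> ropes A"
  by (auto simp: ropes_iff)

lemma ropes_arcs:
  assumes "(u, v, N, D) \<in> ropes A"
  shows "(u, v) \<in> A" "w \<in> N \<Longrightarrow> (u, w) \<in> A" "w \<in> N \<Longrightarrow> (w, v) \<in> A"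
    "w \<in> D \<Longrightarrow> (u, w) \<in> A" "w \<in> D \<Longrightarrow> (w, v) \<in> A"
  using assms by (auto simp: ropes_iff between_def)

lemma ropes_not_in:
  assumes "(u, v, N, D) \<in> ropes A"
  shows "u \<noteq> v" "u \<notin> N" "v \<notin> N" "u \<notin> D" "v \<notin> D" "w \<in> N \<Longrightarrow> w \<notin> D"
  using assms irrefl_A by (auto simp: ropes_iff between_def)

lemma ropes_adjacent:
  assumes "(u, v, N, D) \<in> ropes A" "a \<in> {u, v} \<union> N \<union> D" "b \<in> {u, v} \<union> N \<union> D"
  shows "a = b \<or> (a, b) \<in> A \<or> (b, a) \<in> A"
proof -
  have "(u, v) \<in> A" "N \<union> D = between u v" using assms(1) by (auto simp: ropes_iff)
  then have "a \<in> {u, v} \<or> a \<in> between u v" "b \<in> {u, v} \<or> b \<in> between u v"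
    using assms(2,3) by auto
  moreover have "(u, w) \<in> A \<and> (w, v) \<in> A" if "w \<in> between u v" for w
    using that by (simp add: between_def)
  ultimately show ?thesis using \<open>(u, v) \<in> A\<close> between_adjacent by blast
qed

text \<open>The ends lie in a clique, and the opposite arc would close a directed cycle.\<close>

lemma ropes_transitive:
  assumes "(u, v, N, D) \<in> ropes A" "a \<in> {u, v} \<union> N \<union> D" "c \<in> {u, v} \<union> N \<union> D"
    "(a, b) \<in> A" "(b, c) \<in> A"
  shows "(a, c) \<in> A"
proof -
  have "(a, c) \<in> A\<^sup>+" using assms(4,5) by (meson r_into_trancl' trancl_trans)
  then show ?thesis
    using ropes_adjacent[OF assms(1-3)] no_cycle by (meson r_into_trancl' trancl_trans)
qed

text \<open>A path from \<open>u\<close> through \<open>a\<close>, \<open>w\<close> and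
  \<open>b\<close> to \<open>v\<close> puts \<open>w\<close> in the transitive support of
  \<open>(u, v)\<close>.\<close>

lemma between_subset:
  assumes r: "(u, v, N, D) \<in> ropes A" and a: "a \<in> {u, v} \<union> N \<union> D" and b: "b \<in> {u, v} \<union> N \<union> D"
  shows "between a b \<subseteq> N \<union> D"
proof
  fix w
  assume "w \<in> between a b"
  then have w: "(a, w) \<in> A" "(w, b) \<in> A" by (auto simp: between_def)
  have "(u, a) \<in> A\<^sup>*" "(b, v) \<in> A\<^sup>*" using a b ropes_arcs[OF r] by blast+
  then have "(u, w) \<in> A\<^sup>+" "(w, v) \<in> A\<^sup>+"
    using w by (auto intro: rtrancl_into_trancl1 rtrancl_into_trancl2)
  then have "w \<in> between u v"
    using arcs_through[OF ropes_arcs(1)[OF r]] by (auto simp: between_def)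
  then show "w \<in> N \<union> D" using r by (auto simp: ropes_iff)
qed

lemma subrope_restrict:
  assumes r: "(u, v, N, D) \<in> ropes A" and a: "a \<in> {u, v} \<union> N \<union> D" and b: "b \<in> {u, v} \<union> N \<union> D"
    and ab: "(a, b) \<in> A"
  shows "subrope A (a, b, N \<inter> between a b, D \<inter> between a b) (u, v, N, D)"
  using between_subset[OF r a b] r a b ab by (auto simp: subrope_def ropes_iff)

text \<open>
  Reversing these arcs puts the transitive support of \<open>(u, v)\<close> in the order \<open>N, v, u, D\<close>.  With \<open>N\<close>
  and \<open>D\<close> swapped, they are the arcs that the meet irreducible of the rope does not reverse.
\<close>

definition rope_arcs :: "'a \<Rightarrow> 'a \<Rightarrow> 'a set \<Rightarrow> 'a set \<Rightarrow> 'a rel" where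
  "rope_arcs u v N D = {(a, b) \<in> A. a \<in> insert u D \<and> b \<in> insert v N}"

lemma rope_arcs_between:
  assumes "(u, v, N, D) \<in> ropes A" "(a, c) \<in> rope_arcs u v N D" "(a, b) \<in> A" "(b, c) \<in> A"
  shows "b \<in> N \<union> D"
  using between_subset[OF assms(1), of a c] assms by (auto simp: rope_arcs_def between_def)

text \<open>Tails lie in \<open>insert u D\<close> and heads in \<open>insert v N\<close>, which are
  disjoint. Hence the closure condition holds vacuously for \<open>rope_arcs\<close>.\<close>

lemma rope_arcs_no_path:
  assumes "(u, v, N, D) \<in> ropes A" "(a, b) \<in> rope_arcs u v N D"
  shows "(b, c) \<notin> rope_arcs u v N D"
  using assms(2) ropes_not_in[OF assms(1)] by (auto simp: rope_arcs_def)

lemma biclosed_rope_arcs: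
  assumes r: "(u, v, N, D) \<in> ropes A"
  shows "biclosed (rope_arcs u v N D)"
proof (rule biclosedI)
  fix a b c
  assume "(a, b) \<in> A" "(b, c) \<in> A" "(a, c) \<in> rope_arcs u v N D" "(a, b) \<notin> rope_arcs u v N D"
  then show "(b, c) \<in> rope_arcs u v N D"
    using rope_arcs_between[OF r, of a c b] by (auto simp: rope_arcs_def)
qed (use rope_arcs_no_path[OF r] in \<open>auto simp: rope_arcs_def\<close>)

text \<open>The arcs at \<open>u\<close> and \<open>v\<close> are in \<open>X\<close> by assumption.
  An arc \<open>(a, b)\<close> from \<open>D\<close> to \<open>N\<close> follows from coclosure at
  \<open>(u, b)\<close>, as \<open>(u, a)\<close> is not in \<open>X\<close>.\<close>

lemma rope_arcs_subset:
  assumes X: "biclosed X" and r: "(u, v, N, D) \<in> ropes A" and uv: "(u, v) \<in> X"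
    and N: "\<And>w. w \<in> N \<Longrightarrow> (u, w) \<in> X"
    and D: "\<And>w. w \<in> D \<Longrightarrow> (w, v) \<in> X" "\<And>w. w \<in> D \<Longrightarrow> (u, w) \<notin> X"
  shows "rope_arcs u v N D \<subseteq> X"
proof clarify
  fix a b
  assume "(a, b) \<in> rope_arcs u v N D"
  then have ab: "(a, b) \<in> A" "a = u \<or> a \<in> D" "b = v \<or> b \<in> N" by (auto simp: rope_arcs_def)
  show "(a, b) \<in> X"
  proof (cases "a \<in> D \<and> b \<in> N")
    case True
    then show ?thesis
      using biclosed_coclosed[OF X, of u b a] N D ropes_arcs[OF r] ab(1) by blast
  qed (use ab uv N D in auto)
qed

text \<open>The hypothesis \<open>meets\<close> says that \<open>X\<close> is not below the meet
  irreducible of the rope. An arc of the intersection with fewest vertices between its ends then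
  carries a subrope whose join irreducible is below \<open>X\<close>. This links the two
  descriptions of the congruence.\<close>

lemma rope_below_if_meets:
  assumes X: "biclosed X" and r: "(u, v, N, D) \<in> ropes A"
    and meets: "X \<inter> rope_arcs u v D N \<noteq> {}"
  obtains a b N' D' where "subrope A (a, b, N', D') (u, v, N, D)"
    "rope_arcs a b N' D' \<subseteq> X" "(a, b) \<in> rope_arcs u v D N"
proof -
  let ?K = "rope_arcs u v D N"
  \<comment> \<open>Minimality of \<open>e = (a, b)\<close> and coclosure of \<open>X\<close> determine which arcs at \<open>a\<close> and \<open>b\<close> are in \<open>X\<close>.\<close>
  obtain e where e: "e \<in> X \<inter> ?K"
    and min: "\<And>e'. e' \<in> X \<inter> ?K \<Longrightarrow>
      card (between (fst e) (snd e)) \<le> card (between (fst e') (snd e'))"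
    using meets ex_has_least_nat[of "\<lambda>e. e \<in> X \<inter> ?K" _ "\<lambda>e. card (between (fst e) (snd e))"]
    by blast
  obtain a b where ab: "e = (a, b)" by (cases e)
  have abX: "(a, b) \<in> X" "(a, b) \<in> ?K" "(a, b) \<in> A" using e ab by (auto simp: rope_arcs_def)
  have mem: "a \<in> {u, v} \<union> N \<union> D" "b \<in> {u, v} \<union> N \<union> D" using abX by (auto simp: rope_arcs_def)
  let ?N = "N \<inter> between a b" and ?D = "D \<inter> between a b"
  have sub: "subrope A (a, b, ?N, ?D) (u, v, N, D)"
    by (rule subrope_restrict[OF r mem abX(3)])
  then have rab: "(a, b, ?N, ?D) \<in> ropes A" by (simp add: subrope_def)
  have fin: "finite (between a b)"
    by (rule finite_subset[of _ "snd ` A"]) (use finite_A in \<open>force simp: between_def\<close>)+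
  have less: "card (between c d) < card (between a b)"
    if "c \<in> {a, b} \<union> between a b" "d \<in> {a, b} \<union> between a b" "c \<in> between a b \<or> d \<in> between a b" for c d
  proof (rule psubset_card_mono[OF fin])
    have "between c d \<subseteq> between a b"
      using between_subset[OF rab, of c d] that rab by (auto simp: ropes_iff)
    moreover have "c \<notin> between c d" "d \<notin> between c d" using irrefl_A by (auto simp: between_def)
    ultimately show "between c d \<subset> between a b" using that by blast
  qed
  have N: "(a, w) \<in> X" if w: "w \<in> ?N" for w
  proof -
    have "card (between w b) < card (between a b)" using w by (intro less) auto
    then have "(w, b) \<notin> X \<inter> ?K" using min[of "(w, b)"] ab by auto
    moreover have "(w, b) \<in> ?K" using w abX by (auto simp: rope_arcs_def between_def)
    ultimately show ?thesis
      using biclosed_coclosed[OF X abX(1), of w] w by (auto simp: between_def)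
  qed
  have D: "(a, w) \<notin> X" "(w, b) \<in> X" if w: "w \<in> ?D" for w
  proof -
    have "card (between a w) < card (between a b)" using w by (intro less) auto
    then have "(a, w) \<notin> X \<inter> ?K" using min[of "(a, w)"] ab by auto
    moreover have "(a, w) \<in> ?K" using w abX by (auto simp: rope_arcs_def between_def)
    ultimately show "(a, w) \<notin> X" by blast
    then show "(w, b) \<in> X"
      using biclosed_coclosed[OF X abX(1), of w] w by (auto simp: between_def)
  qed
  show ?thesis
    using that[OF sub rope_arcs_subset[OF X rab abX(1)] abX(2)] N D by blast
qed

section \<open>The congruence of a set of ropes\<close>

definition rope_congruence :: "'a rope set \<Rightarrow> 'a rel rel" where
  "rope_congruence U = {(X, Y). biclosed X \<and> biclosed Y \<and>
    (\<forall>u v N D. (u, v, N, D) \<in> U \<longrightarrow>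
      (rope_arcs u v N D \<subseteq> X \<longleftrightarrow> rope_arcs u v N D \<subseteq> Y))}"

text \<open>Both inclusions rest on \<open>rope_below_if_meets\<close>, whose subrope stays in
  \<open>U\<close>. The second one applies it to the complement of \<open>Y\<close>, with the two
  sides of the rope exchanged.\<close>

lemma rope_congruence_dual:
  assumes U: "U \<subseteq> ropes A" and down: "\<forall>s\<in>U. \<forall>r. subrope A r s \<longrightarrow> r \<in> U"
  shows "rope_congruence U = {(X, Y). biclosed X \<and> biclosed Y \<and>
    (\<forall>u v N D. (u, v, N, D) \<in> U \<longrightarrow>
      (X \<inter> rope_arcs u v D N = {} \<longleftrightarrow> Y \<inter> rope_arcs u v D N = {}))}"
    (is "_ = ?R")
proof -
  have 1: "Y \<inter> rope_arcs u v D N \<noteq> {}"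
    if XY: "biclosed X" "biclosed Y" and
      same: "\<And>u v N D. \<lbrakk>(u, v, N, D) \<in> U; rope_arcs u v N D \<subseteq> X\<rbrakk> \<Longrightarrow> rope_arcs u v N D \<subseteq> Y" and
      r: "(u, v, N, D) \<in> U" "X \<inter> rope_arcs u v D N \<noteq> {}" for X Y u v N D
  proof -
    have "(u, v, N, D) \<in> ropes A" using r(1) U by blast
    from rope_below_if_meets[OF XY(1) this r(2)]
    obtain a b N' D' where ab: "subrope A (a, b, N', D') (u, v, N, D)"
      "rope_arcs a b N' D' \<subseteq> X" "(a, b) \<in> rope_arcs u v D N" .
    then have "rope_arcs a b N' D' \<subseteq> Y" using same down r(1) by blast
    moreover have "(a, b) \<in> rope_arcs a b N' D'" using ab(3) by (auto simp: rope_arcs_def)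
    ultimately show ?thesis using ab(3) by blast
  qed
  have 2: "rope_arcs u v N D \<subseteq> Y"
    if XY: "biclosed X" "biclosed Y" and
      same: "\<And>u v N D. \<lbrakk>(u, v, N, D) \<in> U; Y \<inter> rope_arcs u v D N = {}\<rbrakk> \<Longrightarrow> X \<inter> rope_arcs u v D N = {}" and
      r: "(u, v, N, D) \<in> U" "rope_arcs u v N D \<subseteq> X" for X Y u v N D
  proof (rule ccontr)
    assume "\<not> rope_arcs u v N D \<subseteq> Y"
    then have "(A - Y) \<inter> rope_arcs u v N D \<noteq> {}" by (auto simp: rope_arcs_def)
    moreover have "(u, v, D, N) \<in> ropes A" using r(1) U ropes_swap by blast
    ultimately obtain a b N' D' where ab: "subrope A (a, b, N', D') (u, v, D, N)"
      "rope_arcs a b N' D' \<subseteq> A - Y" "(a, b) \<in> rope_arcs u v N D"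
      using rope_below_if_meets[OF biclosed_complement[OF XY(2)]] by metis
    have "subrope A (a, b, D', N') (u, v, N, D)"
      using ab(1) by (auto simp: subrope_def ropes_swap)
    then have "X \<inter> rope_arcs a b N' D' = {}" using same[of a b D' N'] down r(1) ab(2) by blast
    moreover have "(a, b) \<in> rope_arcs a b N' D'" using ab(3) by (auto simp: rope_arcs_def)
    ultimately show False using ab(3) r(2) by blast
  qed
  show ?thesis
  proof (intro equalityI subrelI)
    fix X Y
    assume "(X, Y) \<in> rope_congruence U"
    then have XY: "biclosed X" "biclosed Y"
      "\<And>u v N D. (u, v, N, D) \<in> U \<Longrightarrow> rope_arcs u v N D \<subseteq> X \<longleftrightarrow> rope_arcs u v N D \<subseteq> Y"
      unfolding rope_congruence_def by blast+
    have "X \<inter> rope_arcs u v D N = {} \<longleftrightarrow> Y \<inter> rope_arcs u v D N = {}" if "(u, v, N, D) \<in> U" for u v N D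
      using 1[OF XY(1,2) _ that] 1[OF XY(2,1) _ that] XY(3) by metis
    then show "(X, Y) \<in> ?R" using XY(1,2) by blast
  next
    fix X Y
    assume "(X, Y) \<in> ?R"
    then have XY: "biclosed X" "biclosed Y"
      "\<And>u v N D. (u, v, N, D) \<in> U \<Longrightarrow> X \<inter> rope_arcs u v D N = {} \<longleftrightarrow> Y \<inter> rope_arcs u v D N = {}"
      by blast+
    have "rope_arcs u v N D \<subseteq> X \<longleftrightarrow> rope_arcs u v N D \<subseteq> Y" if "(u, v, N, D) \<in> U" for u v N D
      using 2[OF XY(1,2) _ that] 2[OF XY(2,1) _ that] XY(3) by metis
    then show "(X, Y) \<in> rope_congruence U" using XY(1,2) unfolding rope_congruence_def by blast
  qed
qed

text \<open>Both \<open>A - rope_arcs u v D N\<close> and \<open>rope_arcs u v N D\<close> are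
  lattice elements. A join is below the former iff both joinands are, and a meet is above the latter
  iff both arguments are.\<close>

lemma lattice_congruence_rope_congruence:
  assumes U: "U \<subseteq> ropes A" and down: "\<forall>s\<in>U. \<forall>r. subrope A r s \<longrightarrow> r \<in> U"
  shows "lattice_congruence L (rope_congruence U)"
proof -
  interpret lattice L by (rule lattice_L)
  let ?R = "rope_congruence U"
  have join: "(X \<squnion>\<^bsub>L\<^esub> Y) \<inter> rope_arcs u v D N = {} \<longleftrightarrow>
      X \<inter> rope_arcs u v D N = {} \<and> Y \<inter> rope_arcs u v D N = {}"
    if XY: "biclosed X" "biclosed Y" and r: "(u, v, N, D) \<in> U" for X Y u v N D
  proof -
    let ?M = "A - rope_arcs u v D N"
    have M: "biclosed ?M" using r U ropes_swap biclosed_complement biclosed_rope_arcs by blast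
    have disj: "Z \<inter> rope_arcs u v D N = {} \<longleftrightarrow> Z \<subseteq> ?M" if "biclosed Z" for Z
      using biclosed_subset[OF that] by blast
    have "biclosed (X \<squnion>\<^bsub>L\<^esub> Y)" using join_closed[of X Y] XY by simp
    then show ?thesis
      using disj XY join_le[where x = X and y = Y and z = ?M] join_left[of X Y] join_right[of X Y] M
      by auto
  qed
  have meet: "rope_arcs u v N D \<subseteq> X \<sqinter>\<^bsub>L\<^esub> Y \<longleftrightarrow> rope_arcs u v N D \<subseteq> X \<and> rope_arcs u v N D \<subseteq> Y"
    if XY: "biclosed X" "biclosed Y" and r: "(u, v, N, D) \<in> U" for X Y u v N D
  proof -
    have "biclosed (rope_arcs u v N D)" using r U biclosed_rope_arcs by blast
    then show ?thesis
      using XY meet_le[where x = X and y = Y and z = "rope_arcs u v N D"]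
        meet_left[of X Y] meet_right[of X Y]
      by auto
  qed
  note dual = rope_congruence_dual[OF U down]
  have "equiv (carrier L) ?R"
    by (rule equivI) (auto simp: rope_congruence_def refl_on_def sym_def trans_def)
  moreover have "(X \<squnion>\<^bsub>L\<^esub> Y, X' \<squnion>\<^bsub>L\<^esub> Y') \<in> ?R" if "(X, X') \<in> ?R" "(Y, Y') \<in> ?R" for X X' Y Y'
    using that join join_closed[of X Y] join_closed[of X' Y'] unfolding dual by simp
  moreover have "(X \<sqinter>\<^bsub>L\<^esub> Y, X' \<sqinter>\<^bsub>L\<^esub> Y') \<in> ?R" if "(X, X') \<in> ?R" "(Y, Y') \<in> ?R" for X X' Y Y'
    using that meet meet_closed[of X Y] meet_closed[of X' Y']
    unfolding rope_congruence_def by simp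
  ultimately show ?thesis unfolding lattice_congruence_def by blast
qed

section \<open>Forcing\<close>

text \<open>For a suitable \<open>?Z\<close>, the join \<open>?J\<close> with \<open>?Z\<close>
  contains \<open>?J'\<close>, whereas the join \<open>?K\<close> with \<open>?Z\<close> still
  misses \<open>(u', v')\<close>. Cutting both joins down to \<open>?J'\<close> carries the collapse
  over.\<close>

lemma rope_arcs_lower_forced:
  assumes sub: "subrope A (u, v, N, D) (u', v', N', D')"
    and R: "lattice_congruence L R"
    and con: "(rope_arcs u v N D - {(u, v)}, rope_arcs u v N D) \<in> R"
    and lower: "biclosed (rope_arcs u' v' N' D' - {(u', v')})"
  shows "(rope_arcs u' v' N' D' - {(u', v')}, rope_arcs u' v' N' D') \<in> R"
proof -
  interpret lattice L by (rule lattice_L)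
  let ?J = "rope_arcs u v N D" and ?J' = "rope_arcs u' v' N' D'"
  let ?K = "?J - {(u, v)}" and ?K' = "?J' - {(u', v')}"
  let ?S = "{u', v'} \<union> N' \<union> D'"
  have r: "(u, v, N, D) \<in> ropes A" and r': "(u', v', N', D') \<in> ropes A"
    and mem: "u \<in> ?S" "v \<in> ?S" "N \<subseteq> N'" "D \<subseteq> D'"
    using sub by (auto simp: subrope_def)
  have uv: "(u, v) \<in> A" using r by (simp add: ropes_iff)
  note tr = ropes_transitive[OF r'] and adj = ropes_adjacent[OF r']
  note notin = ropes_not_in[OF r] and notin' = ropes_not_in[OF r']
  have pos: "x = u \<or> (x, u) \<in> A \<or> x = v \<or> (v, x) \<in> A \<or> x \<in> N \<union> D" if "x \<in> ?S" for x
  proof -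
    have "N \<union> D = between u v" using r by (simp add: ropes_iff)
    then show ?thesis using adj[OF that mem(1)] adj[OF that mem(2)] by (auto simp: between_def)
  qed
  have first: "u = u' \<or> (u', u) \<in> A" and last: "v = v' \<or> (v, v') \<in> A"
    using mem(1,2) uv ropes_arcs[OF r'] antisym_A by auto
  \<comment> \<open>The restrictions of the larger rope to \<open>(u', u)\<close> and \<open>(v, v')\<close>; empty if the ends coincide.\<close>
  define Z1 where "Z1 = {(a, b) \<in> A. a \<in> insert u' D' \<and> b \<in> insert u N' \<and> (b = u \<or> (b, u) \<in> A)}"
  define Z2 where "Z2 = {(a, b) \<in> A. a \<in> insert v D' \<and> b \<in> insert v' N' \<and> (a = v \<or> (v, a) \<in> A)}"
  let ?Z = "Z1 \<union> Z2"
  have in_S: "a \<in> ?S \<and> b \<in> ?S" if "(a, b) \<in> ?Z" for a b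
    using that mem by (auto simp: Z1_def Z2_def)
  have upper: "x \<noteq> u" "(x, u) \<notin> A" if "x = v \<or> (v, x) \<in> A" for x
    using that uv antisym_A irrefl_A no_cycle by (meson r_into_trancl' trancl_trans)+
  \<comment> \<open>No two arcs of \<open>?Z\<close> compose: \<open>Z1\<close> lives at or before
    \<open>u\<close>, \<open>Z2\<close> at or after \<open>v\<close>, and neither has composable
    arcs of its own. In coclosure the middle vertex is in \<open>N'\<close> or \<open>D'\<close>,
    which decides the arc to use.\<close>
  have Z: "biclosed ?Z"
  proof (rule biclosedI)
    show "?Z \<subseteq> A" by (auto simp: Z1_def Z2_def)
  next
    fix a b c
    assume ab: "(a, b) \<in> ?Z" and bc: "(b, c) \<in> ?Z"
    have "False" if "(a, b) \<in> Z1" "(b, c) \<in> Z1"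
      using that notin' antisym_A irrefl_A by (auto simp: Z1_def)
    moreover have False if "(a, b) \<in> Z1" "(b, c) \<in> Z2"
      using that upper by (auto simp: Z1_def Z2_def)
    moreover have False if "(a, b) \<in> Z2" "(b, c) \<in> Z1"
    proof -
      have "(v, b) \<in> A" using that(1) tr[of v b a] in_S ab mem by (auto simp: Z2_def)
      then have "(v, c) \<in> A" using that(2) tr[of v c b] in_S bc mem by (auto simp: Z1_def)
      then show False using that(2) upper[of c] by (auto simp: Z1_def)
    qed
    moreover have False if "(a, b) \<in> Z2" "(b, c) \<in> Z2"
      using that notin' antisym_A irrefl_A by (auto simp: Z2_def)
    ultimately show "(a, c) \<in> ?Z" using ab bc by blast
  next
    fix a b c
    assume ab: "(a, b) \<in> A" "(b, c) \<in> A" and ac: "(a, c) \<in> ?Z" and nab: "(a, b) \<notin> ?Z"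
    have b: "b \<in> N' \<union> D'"
      using between_subset[OF r', of a c] in_S[OF ac] ab by (auto simp: between_def)
    have "(b, u) \<in> A" if "(a, c) \<in> Z1"
      using that tr[of b u c] b ab mem by (auto simp: Z1_def)
    moreover have "(v, b) \<in> A" if "(a, c) \<in> Z2"
      using that tr[of v b a] b ab mem by (auto simp: Z2_def)
    ultimately show "(b, c) \<in> ?Z" using b ab ac nab by (auto simp: Z1_def Z2_def)
  qed
  have J: "biclosed ?J" "biclosed ?J'" "biclosed ?K"
    using biclosed_rope_arcs r r' R con by (auto simp: lattice_congruence_def equiv_def)
  let ?W = "?J \<squnion>\<^bsub>L\<^esub> ?Z" and ?M = "?K \<squnion>\<^bsub>L\<^esub> ?Z"
  have W: "biclosed ?W" "?J \<subseteq> ?W" "?Z \<subseteq> ?W" and M: "biclosed ?M"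
    using join_closed[of ?J ?Z] join_left[of ?J ?Z] join_right[of ?J ?Z] join_closed[of ?K ?Z] J Z
    by simp_all
  \<comment> \<open>Arcs ending at or before \<open>u\<close>, or starting at or after
    \<open>v\<close>, are in \<open>?Z\<close>. The others are in \<open>?J\<close> or are composed
    from arcs of \<open>?Z\<close> and \<open>?J\<close>, such as \<open>(a, u)\<close>,
    \<open>(u, v)\<close> and \<open>(v, b)\<close>.\<close>
  have J'W: "?J' \<subseteq> ?W"
  proof clarify
    fix a b
    assume "(a, b) \<in> ?J'"
    then have ab: "(a, b) \<in> A" "a = u' \<or> a \<in> D'" "b = v' \<or> b \<in> N'" by (auto simp: rope_arcs_def)
    then have S: "a \<in> ?S" "b \<in> ?S" by auto
    have Z1: "(a, b) \<in> ?Z" if "b = u \<or> (b, u) \<in> A"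
      using that ab upper last notin' by (auto simp: Z1_def)
    have Z2: "(a, b) \<in> ?Z" if "a = v \<or> (v, a) \<in> A"
      using that ab upper first notin' by (auto simp: Z2_def)
    have vb: "(v, b) \<in> ?Z" if "(v, b) \<in> A" using that ab by (auto simp: Z2_def)
    have au: "(a, u) \<in> ?Z" if "(a, u) \<in> A" using that ab by (auto simp: Z1_def)
    have N: "b \<in> N" if "b \<in> N \<union> D"
      using that ab(3) mem(4) notin' by auto
    have D: "a \<in> D" if "a \<in> N \<union> D"
      using that ab(2) mem(3) notin' by auto
    have uv': "(u, v) \<in> ?W" using W(2) uv by (auto simp: rope_arcs_def)
    have b_cases: "(a, b) \<in> ?W \<or> b = v \<or> b \<in> N \<or> (v, b) \<in> A"
      using pos[OF S(2)] Z1 N W(3) by blast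
    have aW: "a = v \<or> (v, a) \<in> A \<Longrightarrow> (a, b) \<in> ?W" using Z2 W(3) by blast
    show "(a, b) \<in> ?W"
    proof (cases "(a, u) \<in> A")
      case True
      then have auW: "(a, u) \<in> ?W" using au W(3) by blast
      moreover have "(a, v) \<in> A" using True uv tr[OF S(1) mem(2)] by blast
      ultimately have av: "(a, v) \<in> ?W" using uv' W(1) biclosed_closed by blast
      from b_cases show ?thesis
      proof (elim disjE)
        assume "b \<in> N"
        then have "(u, b) \<in> ?W" using W(2) ropes_arcs[OF r] by (auto simp: rope_arcs_def)
        then show ?thesis using auW ab(1) W(1) biclosed_closed by blast
      next
        assume "(v, b) \<in> A"
        then show ?thesis using vb W av ab(1) biclosed_closed by blast
      qed (use av in auto)
    next
      case False
      then consider "(a, b) \<in> ?W" | "a = u \<or> a \<in> D" using pos[OF S(1)] D aW by blast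
      then show ?thesis
      proof cases
        case 2
        then have av: "(a, v) \<in> ?W" using W(2) uv ropes_arcs[OF r] by (auto simp: rope_arcs_def)
        from b_cases show ?thesis
        proof (elim disjE)
          assume "b \<in> N"
          then show ?thesis using 2 ab(1) W(2) by (auto simp: rope_arcs_def)
        next
          assume "(v, b) \<in> A"
          then show ?thesis using vb W av ab(1) biclosed_closed by blast
        qed (use av in auto)
      qed
    qed
  qed
  have "(u', v') \<notin> ?M"
  proof
    assume "(u', v') \<in> ?M"
    let ?C = "(?K \<union> ?Z)\<^sup>+ \<inter> A"
    have C: "biclosed ?C" by (rule biclosed_closure[OF J(3) Z])
    have "?K \<subseteq> ?C" "?Z \<subseteq> ?C"
      using biclosed_subset[OF J(3)] biclosed_subset[OF Z] by (auto intro: r_into_trancl')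
    then have "?M \<subseteq> ?C" using join_le[where x = ?K and y = ?Z and z = ?C] C J Z by simp
    then have path: "(u', v') \<in> (?K \<union> ?Z)\<^sup>+" using \<open>(u', v') \<in> ?M\<close> by blast
    \<comment> \<open>Walks in \<open>?K \<union> ?Z\<close> starting at \<open>u'\<close> stay in
      \<open>?T\<close>: from there, \<open>Z1\<close> leads only to vertices at or before
      \<open>u\<close>, \<open>Z2\<close> has no tail in \<open>?T\<close>, and \<open>?K\<close>
      can be entered only at \<open>u\<close>, where, lacking \<open>(u, v)\<close>, it leads into
      \<open>N\<close>.\<close>
    let ?T = "{u', u} \<union> {b \<in> N'. (b, u) \<in> A} \<union> N"
    have u'v: "u' \<noteq> v" "(v, u') \<notin> A" using first uv upper[of u'] by auto
    have u'D: "u' \<notin> insert u D \<or> u' = u" using mem(4) notin'(4) by auto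
    have step: "b \<in> ?T" if a: "a \<in> ?T" and ab: "(a, b) \<in> ?K \<union> ?Z" for a b
    proof -
      have below: "a \<noteq> v" "(v, a) \<notin> A"
        using a u'v upper[of a] uv notin ropes_arcs(3)[OF r, of a] antisym_A[of a v] irrefl_A
        by auto
      have aD: "a = u' \<or> a = u \<or> a \<notin> D'"
        using a mem(3) notin'(6) by auto
      have "(a, b) \<notin> Z2" using below by (auto simp: Z2_def)
      moreover have "b \<in> ?T" if "(a, b) \<in> Z1" using that by (auto simp: Z1_def)
      moreover have "b \<in> ?T" if K: "(a, b) \<in> ?K"
      proof -
        have "a = u"
          using K aD u'D mem(4) by (auto simp: rope_arcs_def)
        then show ?thesis using K by (auto simp: rope_arcs_def)
      qed
      ultimately show ?thesis using ab by blast
    qed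
    have "x \<in> ?T" if "(u', x) \<in> (?K \<union> ?Z)\<^sup>+" for x
      using that by (induction rule: trancl_induct) (use step in blast)+
    then have "v' \<in> ?T" using path by blast
    moreover have "v' \<noteq> u" using last uv antisym_A irrefl_A by auto
    ultimately show False using notin' mem by auto
  qed
  let ?P = "?M \<sqinter>\<^bsub>L\<^esub> ?J'"
  have P: "biclosed ?P" "?P \<subseteq> ?M" "?P \<subseteq> ?J'"
    using meet_closed[of ?M ?J'] meet_left[of ?M ?J'] meet_right[of ?M ?J'] M J by simp_all
  then have PK: "?P \<subseteq> ?K'" using \<open>(u', v') \<notin> ?M\<close> by blast
  have join_eq: "X \<squnion>\<^bsub>L\<^esub> Y = Y" "Y \<squnion>\<^bsub>L\<^esub> X = Y" "Y \<sqinter>\<^bsub>L\<^esub> X = X"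
    if "biclosed X" "biclosed Y" "X \<subseteq> Y" for X Y
  proof -
    have "X \<squnion>\<^bsub>L\<^esub> Y \<subseteq> Y" "Y \<squnion>\<^bsub>L\<^esub> X \<subseteq> Y" "X \<subseteq> Y \<sqinter>\<^bsub>L\<^esub> X"
      using that join_le[where x = X and y = Y and z = Y] join_le[where x = Y and y = X and z = Y]
        meet_le[where x = Y and y = X and z = X] by simp_all
    moreover have "Y \<subseteq> X \<squnion>\<^bsub>L\<^esub> Y" "Y \<subseteq> Y \<squnion>\<^bsub>L\<^esub> X" "Y \<sqinter>\<^bsub>L\<^esub> X \<subseteq> X"
      using that join_right[of X Y] join_left[of Y X] meet_right[of Y X] by simp_all
    ultimately show "X \<squnion>\<^bsub>L\<^esub> Y = Y" "Y \<squnion>\<^bsub>L\<^esub> X = Y" "Y \<sqinter>\<^bsub>L\<^esub> X = X" by blast+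
  qed
  have refl: "(X, X) \<in> R" if "biclosed X" for X
    using R that by (auto simp: lattice_congruence_def equiv_def refl_on_def)
  have compatible: "(X \<squnion>\<^bsub>L\<^esub> Y, X' \<squnion>\<^bsub>L\<^esub> Y) \<in> R" "(X \<sqinter>\<^bsub>L\<^esub> Y, X' \<sqinter>\<^bsub>L\<^esub> Y) \<in> R"
    if "(X, X') \<in> R" "biclosed Y" for X X' Y
    using R that(1) refl[OF that(2)] by (simp_all add: lattice_congruence_def)
  have "(?M, ?W) \<in> R" by (rule compatible(1)[OF con Z])
  then have "(?P, ?W \<sqinter>\<^bsub>L\<^esub> ?J') \<in> R"
    by (rule compatible(2)[OF _ J(2)])
  then have "(?P, ?J') \<in> R" using join_eq(3)[OF J(2) W(1) J'W] by simp
  \<comment> \<open>\<open>?P\<close> may be strictly below \<open>?K'\<close>; joining with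
    \<open>?K'\<close> lifts it to \<open>?K'\<close> and leaves \<open>?J'\<close>
    unchanged.\<close>
  then have "(?P \<squnion>\<^bsub>L\<^esub> ?K', ?J' \<squnion>\<^bsub>L\<^esub> ?K') \<in> R"
    by (rule compatible(1)[OF _ lower])
  then show ?thesis
    using join_eq(1)[OF P(1) lower PK] join_eq(2)[OF lower J(2)] by auto
qed

section \<open>Cover relations and the rope of a join irreducible\<close>

text \<open>Any triangle condition broken by deleting \<open>(u, v)\<close> would exhibit a path of
  length 2 from \<open>v\<close> to \<open>u\<close> in the reorientation, which the transitive
  reduction rules out.\<close>

lemma biclosed_remove_descent:
  assumes J: "biclosed J" and uv: "(u, v) \<in> A" "(v, u) \<in> transitive_reduction (reorient A J)"
  shows "(u, v) \<in> J" "biclosed (J - {(u, v)})" "\<lbrakk>(u, w) \<in> J; (w, v) \<in> J\<rbrakk> \<Longrightarrow> False"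
proof -
  let ?B = "reorient A J"
  have JA: "J \<subseteq> A" using J by (rule biclosed_subset)
  have B: "(v, u) \<in> ?B" and no: "\<not> ((v, w) \<in> ?B \<and> (w, u) \<in> ?B)" for w
    using uv(2) by (auto simp: transitive_reduction_def)
  show J_uv: "(u, v) \<in> J" using B uv(1) antisym_A by (auto simp: reorient_def)
  show no': "\<lbrakk>(u, w) \<in> J; (w, v) \<in> J\<rbrakk> \<Longrightarrow> False" for w
    using no[of w] by (auto simp: reorient_def)
  show "biclosed (J - {(u, v)})"
  proof (rule biclosedI)
    fix a b c
    assume "(a, b) \<in> A" "(b, c) \<in> A" "(a, c) \<in> J - {(u, v)}" "(a, b) \<notin> J - {(u, v)}"
    then show "(b, c) \<in> J - {(u, v)}"
      using biclosed_coclosed[OF J, of a c b] no[of a] no[of c] antisym_A JA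
      unfolding reorient_def by blast
  qed (use JA no' biclosed_closed[OF J] in blast)+
qed

text \<open>Otherwise the reorientation by \<open>Y\<close> contains the transitive reduction of the
  one by \<open>J\<close>, hence a path for each of its arcs. An arc of \<open>J - Y\<close> then
  closes a directed cycle.\<close>

lemma descent_outside:
  assumes J: "biclosed J" and Y: "biclosed Y" "Y \<subset> J"
  shows "\<exists>u v. (u, v) \<in> J \<and> (u, v) \<notin> Y \<and> (v, u) \<in> transitive_reduction (reorient A J)"
proof (rule ccontr)
  assume none: "\<not> ?thesis"
  let ?B = "reorient A J" and ?C = "reorient A Y"
  have JA: "J \<subseteq> A" using J by (rule biclosed_subset)
  have "(a, b) \<in> ?C" if "(a, b) \<in> transitive_reduction ?B" for a b
  proof -
    have "(a, b) \<in> ?B" using that by (auto simp: transitive_reduction_def)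
    then consider "(a, b) \<in> A - J" | "(b, a) \<in> J" by (auto simp: reorient_def)
    then show ?thesis
    proof cases
      case 1
      then show ?thesis using Y(2) by (auto simp: reorient_def)
    next
      case 2
      then have "(b, a) \<in> Y" using that none by blast
      then show ?thesis by (auto simp: reorient_def)
    qed
  qed
  then have sub: "(transitive_reduction ?B)\<^sup>+ \<subseteq> ?C\<^sup>+" by (intro trancl_mono_subset) auto
  obtain u v where uv: "(u, v) \<in> J" "(u, v) \<notin> Y" using Y(2) by auto
  have "finite ?B" using finite_A JA by (auto simp: reorient_def intro: finite_subset)
  moreover have "acyclic ?B" "acyclic ?C"
    using acyclic_reorient_iff J Y biclosed_subset by blast+
  moreover have "(v, u) \<in> ?B" using uv by (auto simp: reorient_def)
  ultimately have "(v, u) \<in> ?C\<^sup>+" using trancl_transitive_reduction[of ?B v u] sub by blast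
  moreover have "(u, v) \<in> ?C" using uv JA by (auto simp: reorient_def)
  ultimately show False using \<open>acyclic ?C\<close> by (meson acyclic_def r_into_trancl' trancl_trans)
qed

text \<open>Below \<open>J\<close>, any \<open>Z\<close> misses a reversed arc of the reduction, so
  it lies under \<open>J\<close> minus that arc, which is biclosed. Conversely nothing fits between
  sets that differ by one arc.\<close>

lemma covers_iff:
  "covers L J Z \<longleftrightarrow> biclosed J \<and>
    (\<exists>u v. (u, v) \<in> A \<and> (v, u) \<in> transitive_reduction (reorient A J) \<and> Z = J - {(u, v)})"
    (is "?l \<longleftrightarrow> ?r")
proof
  assume cov: ?l
  then have JZ: "biclosed J" "biclosed Z" "Z \<subset> J" by (auto simp: covers_def)
  obtain u v where uv: "(u, v) \<in> J" "(u, v) \<notin> Z" "(v, u) \<in> transitive_reduction (reorient A J)"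
    using descent_outside[OF JZ] by blast
  have "(u, v) \<in> A" using uv(1) JZ(1) biclosed_subset by blast
  have "biclosed (J - {(u, v)})" using biclosed_remove_descent(2)[OF JZ(1) \<open>(u, v) \<in> A\<close> uv(3)] .
  moreover have "J - {(u, v)} \<subset> J" using uv(1) by blast
  ultimately have "\<not> Z \<subset> J - {(u, v)}" using cov unfolding covers_def by (metis carrier_L lless_L)
  then have "Z = J - {(u, v)}" using JZ(3) uv(2) by blast
  then show ?r using JZ(1) \<open>(u, v) \<in> A\<close> uv(3) by blast
next
  assume ?r
  then obtain u v where uv: "biclosed J" "(u, v) \<in> A" "(v, u) \<in> transitive_reduction (reorient A J)"
    "Z = J - {(u, v)}" by blast
  then show ?l
    using biclosed_remove_descent[OF uv(1-3)] unfolding covers_def by auto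
qed

text \<open>A unique lower cover means a unique reversed arc \<open>(u, v)\<close> in the reduction.
  By \<open>descent_outside\<close>, \<open>J\<close> is then the least biclosed subset of itself
  containing \<open>(u, v)\<close>, and \<open>rope_arcs\<close> of its rope is such a
  subset.\<close>

lemma join_irreducible_rope:
  assumes J: "join_irreducible L J"
  obtains u v N D where "rope_of A J = (u, v, N, D)" "(u, v, N, D) \<in> ropes A"
    "J = rope_arcs u v N D" "lower_cover L J = J - {(u, v)}" "biclosed (J - {(u, v)})"
    "\<And>Y. \<lbrakk>biclosed Y; Y \<subseteq> J; (u, v) \<in> Y\<rbrakk> \<Longrightarrow> Y = J"
proof -
  let ?B = "reorient A J"
  have bJ: "biclosed J" and ex1: "\<exists>!Z. covers L J Z"
    using J by (auto simp: join_irreducible_def)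
  have JA: "J \<subseteq> A" using bJ by (rule biclosed_subset)
  obtain Z where Z: "covers L J Z" using ex1 by (rule ex1E)
  obtain u v where uv: "(u, v) \<in> A" "(v, u) \<in> transitive_reduction ?B"
    using Z[unfolded covers_iff] by (elim conjE exE)
  note desc = biclosed_remove_descent[OF bJ uv]
  have covI: "covers L J (J - {(a, b)})"
    if "(a, b) \<in> A" "(b, a) \<in> transitive_reduction ?B" for a b
    unfolding covers_iff by (intro conjI exI) (rule bJ that refl)+
  then have cov: "covers L J (J - {(u, v)})" using uv by simp
  have unique: "a = u \<and> b = v" if "(a, b) \<in> A" "(b, a) \<in> transitive_reduction ?B" for a b
  proof -
    have "covers L J (J - {(a, b)})" using covI[OF that] .
    then have "J - {(a, b)} = J - {(u, v)}" using ex1 cov by blast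
    then show ?thesis using desc(1) biclosed_remove_descent(1)[OF bJ that] by blast
  qed
  have lc: "lower_cover L J = J - {(u, v)}"
    unfolding lower_cover_def using ex1 cov by (rule the1_equality)
  have "reversed_arc A J = (u, v)"
    unfolding reversed_arc_def
  proof (rule the_equality)
    show "x = (u, v)"
      if "case x of (a, b) \<Rightarrow> (a, b) \<in> A \<and> (b, a) \<in> transitive_reduction ?B" for x
      using that unique[of "fst x" "snd x"] by (cases x) simp
  qed (simp add: uv)
  define N where "N = {w. (u, w) \<in> J \<and> (w, v) \<in> A - J}"
  define D where "D = {w. (u, w) \<in> A - J \<and> (w, v) \<in> J}"
  have "A - ?B = J" "A \<inter> ?B = A - J" using JA antisym_A by (auto simp: reorient_def)
  then have rope: "rope_of A J = (u, v, N, D)"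
    by (simp add: rope_of_def \<open>reversed_arc A J = (u, v)\<close> N_def D_def Let_def
        del: Diff_iff Int_iff)
  have minimal: "Y = J" if Y: "biclosed Y" "Y \<subseteq> J" "(u, v) \<in> Y" for Y
  proof (rule ccontr)
    assume "Y \<noteq> J"
    then obtain a b where "(a, b) \<in> J" "(a, b) \<notin> Y" "(b, a) \<in> transitive_reduction ?B"
      using descent_outside[OF bJ Y(1)] Y(2) by blast
    then show False using unique Y(3) JA by blast
  qed
  \<comment> \<open>Coclosure puts at least one of \<open>(u, w)\<close> and \<open>(w, v)\<close>
    in \<open>J\<close>, and \<open>desc(3)\<close> forbids both.\<close>
  have r: "(u, v, N, D) \<in> ropes A"
    using uv(1) JA desc(1,3) biclosed_coclosed[OF bJ desc(1)]
    by (auto simp: ropes_iff N_def D_def between_def)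
  have "rope_arcs u v N D \<subseteq> J"
    by (rule rope_arcs_subset[OF bJ r desc(1)]) (auto simp: N_def D_def)
  moreover have "(u, v) \<in> rope_arcs u v N D" using uv(1) by (auto simp: rope_arcs_def)
  ultimately have "J = rope_arcs u v N D" using minimal biclosed_rope_arcs[OF r] by blast
  then show ?thesis using that rope r lc desc(2) minimal by blast
qed

section \<open>Forcing compared with the subrope order\<close>

lemma subrope_refl: "r \<in> ropes A \<Longrightarrow> subrope A r r"
  by (cases r) (auto simp: subrope_def)

lemma subrope_trans:
  assumes "subrope A r s" "subrope A s t"
  shows "subrope A r t"
proof -
  obtain u v N D u' v' N' D' u'' v'' N'' D''
    where eqs: "r = (u, v, N, D)" "s = (u', v', N', D')" "t = (u'', v'', N'', D'')"
    by (cases r, cases s, cases t) blast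
  have "N \<subseteq> N'" "D \<subseteq> D'" "{u, v} \<subseteq> {u', v'} \<union> (N' \<union> D')" "r \<in> ropes A"
    using assms(1) by (simp_all add: eqs subrope_def)
  moreover have "N' \<subseteq> N''" "D' \<subseteq> D''" "{u', v'} \<subseteq> {u'', v''} \<union> (N'' \<union> D'')" "t \<in> ropes A"
    using assms(2) by (simp_all add: eqs subrope_def)
  ultimately have "N \<subseteq> N''" "D \<subseteq> D''" "{u, v} \<subseteq> {u'', v''} \<union> (N'' \<union> D'')"
    by (meson Un_least Un_mono Un_upper1 Un_upper2 order_trans)+
  then show ?thesis using \<open>r \<in> ropes A\<close> \<open>t \<in> ropes A\<close> by (simp add: eqs subrope_def)
qed

text \<open>Each rope's arc occurs among the arcs of the other, so by antisymmetry the ends agree.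
  Then \<open>N\<close> consists of the heads other than \<open>v\<close> of arcs from
  \<open>u\<close>, and \<open>D\<close> is the rest of \<open>between u v\<close>.\<close>

lemma rope_arcs_inject:
  assumes r: "(u, v, N, D) \<in> ropes A" and s: "(u', v', N', D') \<in> ropes A"
    and eq: "rope_arcs u v N D = rope_arcs u' v' N' D'"
  shows "(u, v, N, D) = (u', v', N', D')"
proof -
  have uv: "(u, v) \<in> A" "(u', v') \<in> A" using r s by (auto simp: ropes_iff)
  then have "(u, v) \<in> rope_arcs u v N D" "(u', v') \<in> rope_arcs u' v' N' D'"
    by (auto simp: rope_arcs_def)
  then have "(u, v) \<in> rope_arcs u' v' N' D'" "(u', v') \<in> rope_arcs u v N D"
    using eq by simp_all
  then have "u = u' \<or> (u', u) \<in> A" "u' = u \<or> (u, u') \<in> A" "v = v' \<or> (v, v') \<in> A"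
    "v' = v \<or> (v', v) \<in> A"
    using ropes_arcs(4)[OF r] ropes_arcs(4)[OF s] ropes_arcs(3)[OF r] ropes_arcs(3)[OF s]
    by (auto simp: rope_arcs_def)
  then have "u = u' \<and> v = v'" using antisym_A by blast
  moreover have "N = {w. (u, w) \<in> rope_arcs u v N D} - {v}"
    using ropes_arcs(2)[OF r] ropes_not_in(3)[OF r] by (auto simp: rope_arcs_def)
  moreover have "N' = {w. (u', w) \<in> rope_arcs u' v' N' D'} - {v'}"
    using ropes_arcs(2)[OF s] ropes_not_in(3)[OF s] by (auto simp: rope_arcs_def)
  moreover have "D = between u v - N" "D' = between u' v' - N'"
    using r s by (auto simp: ropes_iff)
  ultimately show ?thesis using eq by auto
qed

lemma forces_iff_subrope:
  assumes J: "join_irreducible L J" and J': "join_irreducible L J'"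
  shows "forces L J J' \<longleftrightarrow> subrope A (rope_of A J) (rope_of A J')"
proof -
  obtain u v N D where r: "rope_of A J = (u, v, N, D)" "(u, v, N, D) \<in> ropes A"
    "J = rope_arcs u v N D" "lower_cover L J = J - {(u, v)}" "biclosed (J - {(u, v)})"
    "\<And>Y. \<lbrakk>biclosed Y; Y \<subseteq> J; (u, v) \<in> Y\<rbrakk> \<Longrightarrow> Y = J"
    using join_irreducible_rope[OF J] by metis
  obtain u' v' N' D' where r': "rope_of A J' = (u', v', N', D')" "(u', v', N', D') \<in> ropes A"
    "J' = rope_arcs u' v' N' D'" "lower_cover L J' = J' - {(u', v')}" "biclosed (J' - {(u', v')})"
    using join_irreducible_rope[OF J'] by metis
  show ?thesis
  proof
    assume "subrope A (rope_of A J) (rope_of A J')"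
    then show "forces L J J'"
      unfolding forces_def con_def r(4) r'(4)
      using rope_arcs_lower_forced[of u v N D u' v' N' D'] r r' by auto
  next
    assume forces: "forces L J J'"
    show "subrope A (rope_of A J) (rope_of A J')"
    proof (rule ccontr)
      assume nsub: "\<not> ?thesis"
      define U where "U = {s \<in> ropes A. \<not> subrope A (u, v, N, D) s}"
      let ?R = "rope_congruence U"
      have cong: "lattice_congruence L ?R"
      proof (rule lattice_congruence_rope_congruence)
        show "\<forall>s\<in>U. \<forall>t. subrope A t s \<longrightarrow> t \<in> U"
        proof (intro ballI allI impI)
          fix s t
          assume "s \<in> U" and ts: "subrope A t s"
          then have "\<not> subrope A (u, v, N, D) t" using subrope_trans unfolding U_def by blast
          moreover have "t \<in> ropes A" using ts by (cases t) (simp add: subrope_def)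
          ultimately show "t \<in> U" by (simp add: U_def)
        qed
      qed (simp add: U_def)
      \<comment> \<open>By minimality of \<open>J\<close>, an element
        \<open>rope_arcs a b M E\<close> below \<open>J\<close> that contains \<open>(u, v)\<close>
        is \<open>J\<close> itself, and the rope of \<open>J\<close> is not in \<open>U\<close>. So
        \<open>J\<close> and its lower cover are above the same join irreducibles from
        \<open>U\<close>.\<close>
      have "rope_arcs a b M E \<subseteq> J - {(u, v)}"
        if s: "(a, b, M, E) \<in> U" "rope_arcs a b M E \<subseteq> J" for a b M E
      proof (rule ccontr)
        assume "\<not> ?thesis"
        then have "(u, v) \<in> rope_arcs a b M E" using s(2) by blast
        moreover have sr: "(a, b, M, E) \<in> ropes A" using s(1) by (auto simp: U_def)
        ultimately have "rope_arcs a b M E = J" using r(6) s(2) biclosed_rope_arcs by blast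
        then have "(a, b, M, E) = (u, v, N, D)"
          using rope_arcs_inject[OF sr r(2)] r(3) by simp
        then show False using s(1) subrope_refl r(2) by (auto simp: U_def)
      qed
      moreover have "biclosed J" using r(2,3) biclosed_rope_arcs by simp
      ultimately have "(J - {(u, v)}, J) \<in> ?R"
        using r(5) unfolding rope_congruence_def by blast
      then have "con L (lower_cover L J) J \<subseteq> ?R" using cong r(4) by (auto simp: con_def)
      moreover have "(lower_cover L J', J') \<in> con L (lower_cover L J') J'"
        by (auto simp: con_def)
      ultimately have "(J' - {(u', v')}, J') \<in> ?R" using forces r'(4) by (auto simp: forces_def)
      moreover have "(u', v', N', D') \<in> U" using nsub r(1) r'(1,2) by (auto simp: U_def)
      ultimately have "J' \<subseteq> J' - {(u', v')}" using r'(3) unfolding rope_congruence_def by blast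
      moreover have "(u', v') \<in> J'" using r'(2,3) by (auto simp: ropes_iff rope_arcs_def)
      ultimately show False by blast
    qed
  qed
qed

end

theorem proposition37:
  fixes V :: "'a set" and A J J' :: "'a rel"
  assumes "dag V A"
    and "skeletal V A"
    and "join_irreducible (acyclic_reorientations A) J"
    and "join_irreducible (acyclic_reorientations A) J'"
  shows "forces (acyclic_reorientations A) J J' \<longleftrightarrow> subrope A (rope_of A J) (rope_of A J')"
proof -
  interpret skeletal_dag V A using assms(1,2) by unfold_locales
  show ?thesis using assms(3,4) by (rule forces_iff_subrope)
qed

end
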